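(* Let $c\in(0,1)$ be a universal constant for which the Sudakov minoration bound stated in the context holds. Let $T$ be a finite nonempty set, let $\sigma>0$, and let $(X_t)_{t\in T}$ be i.i.d. $\mathcal{N}(0,\sigma^2)$ random variables. Then $$\phi(\beta)\ge\frac{c\,\sigma}{2}\sqrt{\mathbf{E} D_{1/2}(\nu_\beta\|\nu_0)}\qquad\text{for all }\beta\ge0.$$
   Context: For $\beta\ge 0$, the random Gibbs measure $\nu_\beta$ on $T$ is the probability measure with $\nu_\beta(t)=e^{\beta X_t}/Z(\beta)$, $t\in T$, where $Z(\beta)=\sum_{t\in T}e^{\beta X_t}$; in particular $\nu_0$ is the uniform distribution on $T$. The quenched equilibrium free energy is $\phi(\beta):=\frac1\beta\,\mathbf{E}\log\big(\frac{1}{|T|}\sum_{t\in T}e^{\beta X_t}\big)$ for $\beta>0$, and $\phi(0):=\lim_{\beta\downarrow0}\phi(\beta)=0$. For $\alpha\in(0,\infty)$, $\alpha\ne1$, the Rényi divergence of order $\alpha$ between probability measures $\mu,\nu$ on $T$ (with $\nu$ strictly positive) is $D_\alpha(\mu\|\nu):=\frac{1}{\alpha-1}\log\sum_{t\in T}\mu^\alpha(t)\nu^{1-\alpha}(t)$; thus $D_{1/2}(\mu\|\nu)=-2\log\sum_{t\in T}\mu(t)^{1/2}\nu(t)^{1/2}$. $\mathbf{E}$ is expectation with respect to $X$. Sudakov minoration (known result fixing the constant $c$): there is a universal constant $0<c<1$ such that for every finite index set $T$ with $|T|\ge2$ and every centered Gaussian process $(X_t)_{t\in T}$ with $(\mathbf{E}|X_s-X_t|^2)^{1/2}\ge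 a>0$ for all distinct $s,t\in T$, one has $\mathbf{E}[\max_{t\in T}X_t]\ge c\,a\sqrt{\log|T|}$. *)

theory Defs
  imports "HOL-Probability.Probability"
begin

text \<open>Real Gaussian random variables; the degenerate (almost surely constant) case is included,
  since \<^const>\<open>normal_density\<close> only describes the case of positive variance.\<close>

definition gaussian_rv :: "'w measure \<Rightarrow> ('w \<Rightarrow> real) \<Rightarrow> bool" where
  "gaussian_rv M Y \<longleftrightarrow> Y \<in> borel_measurable M \<and>
     ((\<exists>m. AE \<omega> in M. Y \<omega> = m) \<or>
      (\<exists>m s. 0 < s \<and> distributed M lborel Y (normal_density m s)))"

definition centered_gaussian_process ::
    "'w measure \<Rightarrow> 'i set \<Rightarrow> ('i \<Rightarrow> 'w \<Rightarrow> real) \<Rightarrow> bool" where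
  "centered_gaussian_process M T X \<longleftrightarrow> prob_space M \<and>
     (\<forall>F a. finite F \<and> F \<subseteq> T \<longrightarrow> gaussian_rv M (\<lambda>\<omega>. \<Sum>t\<in>F. a t * X t \<omega>)) \<and>
     (\<forall>t\<in>T. prob_space.expectation M (X t) = 0)"

text \<open>A definition cannot quantify over types, so the index sets are sets of naturals and the
  sample spaces live on \<^typ>\<open>nat \<Rightarrow> real\<close>. This loses no generality, because the bound only depends
  on the law of the process, a measure on a finite power of the reals: see
  \<open>sudakov_constantD\<close> below.\<close>

definition sudakov_constant :: "real \<Rightarrow> bool" where
  "sudakov_constant c \<longleftrightarrow>
     (\<forall>(M :: (nat \<Rightarrow> real) measure) (T :: nat set) X a.
        finite T \<and> 2 \<le> card T \<and> centered_gaussian_process M T X \<and> 0 < a \<and>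
        (\<forall>s\<in>T. \<forall>t\<in>T. s \<noteq> t \<longrightarrow>
           a \<le> sqrt (prob_space.expectation M (\<lambda>\<omega>. \<bar>X s \<omega> - X t \<omega>\<bar>\<^sup>2)))
        \<longrightarrow> c * a * sqrt (ln (real (card T))) \<le>
            prob_space.expectation M (\<lambda>\<omega>. Max ((\<lambda>t. X t \<omega>) ` T)))"

lemma gaussian_rv_distr:
  assumes g: "g \<in> measurable M N" and Y: "Y \<in> borel_measurable N"
    and G: "gaussian_rv M (\<lambda>\<omega>. Y (g \<omega>))"
  shows "gaussian_rv (distr M N g) Y"
proof -
  have "(AE \<omega> in distr M N g. Y \<omega> = m) \<longleftrightarrow> (AE \<omega> in M. Y (g \<omega>) = m)" for m
    by (rule AE_distr_iff[OF g]) (use Y in measurable)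
  moreover have "distributed (distr M N g) lborel Y (normal_density m s) \<longleftrightarrow>
      distributed M lborel (\<lambda>\<omega>. Y (g \<omega>)) (normal_density m s)" for m s
    using g Y by (simp add: distributed_def distr_distr comp_def)
  ultimately show ?thesis
    using G Y by (simp add: gaussian_rv_def)
qed

lemma sudakov_constantD:
  fixes M :: "'w measure" and T :: "'i set"
  assumes c: "sudakov_constant c" and fin: "finite T" and card: "2 \<le> card T"
    and X: "centered_gaussian_process M T X" and a: "0 < a"
    and dist: "\<And>s t. s \<in> T \<Longrightarrow> t \<in> T \<Longrightarrow> s \<noteq> t \<Longrightarrow>
      a \<le> sqrt (prob_space.expectation M (\<lambda>\<omega>. \<bar>X s \<omega> - X t \<omega>\<bar>\<^sup>2))"
  shows "c * a * sqrt (ln (real (card T))) \<le>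
    prob_space.expectation M (\<lambda>\<omega>. Max ((\<lambda>t. X t \<omega>) ` T))"
proof -
  interpret prob_space M using X by (simp add: centered_gaussian_process_def)
  define n where "n = card T"
  obtain f where f: "bij_betw f {..<n} T"
    using ex_bij_betw_nat_finite[OF fin] by (auto simp: n_def lessThan_atLeast0)
  have fT: "f i \<in> T" if "i < n" for i
    using f that by (auto simp: bij_betw_def)
  have Xm [measurable]: "X t \<in> borel_measurable M" if "t \<in> T" for t
  proof -
    have "gaussian_rv M (\<lambda>\<omega>. \<Sum>u\<in>{t}. 1 * X u \<omega>)"
      using X that unfolding centered_gaussian_process_def
      by (elim conjE allE[of _ "{t}"] allE[of _ "\<lambda>_. 1"]) auto
    then show ?thesis by (simp add: gaussian_rv_def)
  qed
  define N where "N = PiM (UNIV :: nat set) (\<lambda>_. borel :: real measure)"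
  define g where "g = (\<lambda>\<omega> i. if i < n then X (f i) \<omega> else 0)"
  have g: "g \<in> measurable M N"
    unfolding g_def N_def
  proof (rule measurable_PiM_single')
    fix i show "(\<lambda>\<omega>. if i < n then X (f i) \<omega> else 0) \<in> borel_measurable M"
      by (cases "i < n") (auto intro: Xm fT)
  qed auto
  have co [measurable]: "(\<lambda>x. x i) \<in> borel_measurable N" for i
    unfolding N_def by measurable
  define Q where "Q = distr M N g"
  have cgp: "centered_gaussian_process Q {..<n} (\<lambda>i x. x i)"
    unfolding centered_gaussian_process_def
  proof (intro conjI allI ballI impI)
    show "prob_space Q" unfolding Q_def by (rule prob_space_distr[OF g])
  next
    fix F and b :: "nat \<Rightarrow> real" assume F: "finite F \<and> F \<subseteq> {..<n}"
    have inj: "inj_on f F"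
      using f F by (meson bij_betw_def inj_on_subset)
    have "gaussian_rv M (\<lambda>\<omega>. \<Sum>t\<in>f ` F. b (the_inv_into F f t) * X t \<omega>)"
    proof -
      have "finite (f ` F) \<and> f ` F \<subseteq> T" using F fT by auto
      then show ?thesis
        using X unfolding centered_gaussian_process_def
        by (elim conjE allE[of _ "f ` F"] allE[of _ "\<lambda>t. b (the_inv_into F f t)"]) auto
    qed
    moreover have "(\<Sum>t\<in>f ` F. b (the_inv_into F f t) * X t \<omega>) = (\<Sum>i\<in>F. b i * g \<omega> i)" for \<omega>
      using F by (subst sum.reindex[OF inj])
        (auto simp: g_def the_inv_into_f_f[OF inj] intro!: sum.cong)
    ultimately have "gaussian_rv M (\<lambda>\<omega>. \<Sum>i\<in>F. b i * g \<omega> i)" by simp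
    then show "gaussian_rv Q (\<lambda>x. \<Sum>i\<in>F. b i * x i)"
      unfolding Q_def by (intro gaussian_rv_distr[OF g]) auto
  next
    fix i assume "i \<in> {..<n}"
    then show "integral\<^sup>L Q (\<lambda>x. x i) = 0"
      using X fT unfolding Q_def centered_gaussian_process_def
      by (subst integral_distr[OF g co]) (auto simp: g_def)
  qed
  have d: "a \<le> sqrt (integral\<^sup>L Q (\<lambda>x. \<bar>x i - x j\<bar>\<^sup>2))" if "i < n" "j < n" "i \<noteq> j" for i j
  proof -
    have "f i \<noteq> f j"
      using f that by (auto simp: bij_betw_def inj_on_def)
    then have "a \<le> sqrt (integral\<^sup>L M (\<lambda>\<omega>. \<bar>X (f i) \<omega> - X (f j) \<omega>\<bar>\<^sup>2))"
      using dist fT that by blast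
    then show ?thesis
      unfolding Q_def using that by (subst integral_distr[OF g]) (auto simp: g_def)
  qed
  have "c * a * sqrt (ln (real (card {..<n}))) \<le> integral\<^sup>L Q (\<lambda>x. Max ((\<lambda>i. x i) ` {..<n}))"
    using c[unfolded sudakov_constant_def, rule_format, of "{..<n}" Q "\<lambda>i x. x i" a]
      cgp d a card by (simp add: n_def)
  also have "\<dots> = integral\<^sup>L M (\<lambda>\<omega>. Max ((\<lambda>i. g \<omega> i) ` {..<n}))"
    unfolding Q_def by (rule integral_distr[OF g]) (auto intro!: borel_measurable_Max)
  also have "(\<lambda>\<omega>. Max ((\<lambda>i. g \<omega> i) ` {..<n})) = (\<lambda>\<omega>. Max ((\<lambda>t. X t \<omega>) ` T))"
  proof
    fix \<omega>
    have "(\<lambda>i. g \<omega> i) ` {..<n} = (\<lambda>t. X t \<omega>) ` (f ` {..<n})"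
      by (auto simp: g_def image_iff)
    then show "Max ((\<lambda>i. g \<omega> i) ` {..<n}) = Max ((\<lambda>t. X t \<omega>) ` T)"
      using f by (simp add: bij_betw_def)
  qed
  finally show ?thesis by (simp add: n_def)
qed

text \<open>Probability measures on a finite set \<open>T\<close> are represented by their mass functions.
  In \<open>gibbs\<close>, the argument \<open>x\<close> is a realisation \<open>\<lambda>t. X t \<omega>\<close> of the process.\<close>

definition partition_function :: "'i set \<Rightarrow> ('i \<Rightarrow> real) \<Rightarrow> real \<Rightarrow> real" where
  "partition_function T x \<beta> = (\<Sum>t\<in>T. exp (\<beta> * x t))"

definition gibbs :: "'i set \<Rightarrow> ('i \<Rightarrow> real) \<Rightarrow> real \<Rightarrow> 'i \<Rightarrow> real" where
  "gibbs T x \<beta> t = exp (\<beta> * x t) / partition_function T x \<beta>"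

lemma gibbs_pos: "finite T \<Longrightarrow> T \<noteq> {} \<Longrightarrow> 0 < gibbs T x \<beta> t"
  by (simp add: gibbs_def partition_function_def sum_pos)

lemma sum_gibbs: "finite T \<Longrightarrow> T \<noteq> {} \<Longrightarrow> (\<Sum>t\<in>T. gibbs T x \<beta> t) = 1"
  using sum_pos[of T "\<lambda>t. exp (\<beta> * x t)"]
  by (simp add: gibbs_def partition_function_def flip: sum_divide_distrib)

lemma gibbs_0: "gibbs T x 0 t = 1 / real (card T)"
  by (simp add: gibbs_def partition_function_def)

definition renyi_divergence :: "real \<Rightarrow> 'i set \<Rightarrow> ('i \<Rightarrow> real) \<Rightarrow> ('i \<Rightarrow> real) \<Rightarrow> real" where
  "renyi_divergence \<alpha> T \<mu> \<nu> =
     1 / (\<alpha> - 1) * ln (\<Sum>t\<in>T. \<mu> t powr \<alpha> * \<nu> t powr (1 - \<alpha>))"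

definition free_energy_pos :: "'w measure \<Rightarrow> 'i set \<Rightarrow> ('i \<Rightarrow> 'w \<Rightarrow> real) \<Rightarrow> real \<Rightarrow> real" where
  "free_energy_pos M T X \<beta> =
     1 / \<beta> * prob_space.expectation M
       (\<lambda>\<omega>. ln (1 / real (card T) * (\<Sum>t\<in>T. exp (\<beta> * X t \<omega>))))"

definition free_energy :: "'w measure \<Rightarrow> 'i set \<Rightarrow> ('i \<Rightarrow> 'w \<Rightarrow> real) \<Rightarrow> real \<Rightarrow> real" where
  "free_energy M T X \<beta> =
     (if \<beta> = 0 then Lim (at_right 0) (free_energy_pos M T X) else free_energy_pos M T X \<beta>)"

end

theory Submission
  imports Defs
begin

text \<open>
Write \<open>G(\<beta>) = \<beta> \<phi>(\<beta>)\<close> and \<open>n = |T|\<close>. Since \<open>D\<^sub>1\<^sub>/\<^sub>2(\<nu>\<^sub>\<beta> \<parallel> \<nu>\<^sub>0)\<close> has expectation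
\<open>G(\<beta>) - 2 G(\<beta>/2)\<close>, is pointwise at most \<open>log n\<close>, and \<open>G \<ge> 0\<close>, it suffices that either
\<open>G(\<beta>) \<ge> c\<^sup>2 \<beta>\<^sup>2 \<sigma>\<^sup>2 / 4\<close> or \<open>G(\<beta>) \<ge> (c \<beta> \<sigma> / 2) sqrt (log n)\<close>.

By concavity of the logarithm, the expected log-mean-exp over \<open>T\<close> dominates the one over subsets of
any size \<open>2 \<le> m \<le> n\<close>, which by Sudakov minoration is at least
\<open>sqrt 2 c \<beta> \<sigma> sqrt (log m) - log m\<close>. If \<open>c \<beta> \<sigma>\<close> is large compared with \<open>sqrt (log n)\<close>, take
\<open>m = n\<close>; otherwise choose \<open>m\<close> with \<open>sqrt (log m)\<close> comparable to \<open>c \<beta> \<sigma>\<close>. This fails only if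
\<open>c \<beta> \<sigma>\<close> is below \<open>sqrt (log 2)\<close> up to a constant; then two points suffice, for which the
log-mean-exp is a log-cosh, together with \<open>c \<le> 3/4\<close> (Sudakov minoration for two points).
\<close>

section \<open>Log-mean-exp on finite sets\<close>

text \<open>At \<open>y t = \<beta> * X t \<omega>\<close> and \<open>S = T\<close> its expectation
  is \<beta> times the free energy. The set is an argument because the proof also evaluates it on
  subsets of \<open>T\<close>.\<close>

definition log_mean_exp :: "'i set \<Rightarrow> ('i \<Rightarrow> real) \<Rightarrow> real" where
  "log_mean_exp S y = ln (1 / real (card S) * (\<Sum>t\<in>S. exp (y t)))"

lemma mean_ln_le_ln_mean:
  fixes a :: "'i \<Rightarrow> real"
  assumes "finite S" "S \<noteq> {}" "\<And>t. t \<in> S \<Longrightarrow> 0 < a t"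
  shows "1 / real (card S) * (\<Sum>t\<in>S. ln (a t)) \<le> ln (1 / real (card S) * (\<Sum>t\<in>S. a t))"
  using concave_on_sum[OF assms(1,2) ln_concave, of "\<lambda>_. 1 / real (card S)" a] assms
  by (simp add: sum_distrib_left)

lemma mean_le_log_mean_exp:
  assumes "finite S" "S \<noteq> {}"
  shows "1 / real (card S) * (\<Sum>t\<in>S. y t) \<le> log_mean_exp S y"
  using mean_ln_le_ln_mean[OF assms, of "\<lambda>t. exp (y t)"] by (simp add: log_mean_exp_def)

text \<open>The sum contains the exponential of the maximum, and the normalisation costs
  \<open>ln (card S)\<close>. This turns bounds on expected maxima into bounds on the free
  energy.\<close>

lemma Max_diff_ln_card_le_log_mean_exp:
  assumes "finite S" "S \<noteq> {}"
  shows "Max (y ` S) - ln (real (card S)) \<le> log_mean_exp S y"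
proof -
  have "Max (y ` S) \<in> y ` S" using assms by (intro Max_in) auto
  then obtain t where t: "t \<in> S" "Max (y ` S) = y t" by auto
  have pos: "0 < (\<Sum>t\<in>S. exp (y t))" using assms by (simp add: sum_pos)
  have "y t = ln (exp (y t))" by simp
  also have "\<dots> \<le> ln (\<Sum>t\<in>S. exp (y t))"
    using t assms member_le_sum[of t S "\<lambda>t. exp (y t)"]
    by (subst ln_le_cancel_iff) (auto intro: sum_pos)
  also have "\<dots> = log_mean_exp S y + ln (real (card S))"
    using assms pos by (auto simp: log_mean_exp_def ln_div)
  finally show ?thesis using t by simp
qed

lemma log_mean_exp_le:
  assumes "finite S" "S \<noteq> {}" "\<And>t. t \<in> S \<Longrightarrow> y t \<le> b"
  shows "log_mean_exp S y \<le> b"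
proof -
  have "(\<Sum>t\<in>S. exp (y t)) \<le> real (card S) * exp b"
    using sum_bounded_above[of S "\<lambda>t. exp (y t)" "exp b"] assms by simp
  moreover have "0 < (\<Sum>t\<in>S. exp (y t))" using assms by (simp add: sum_pos)
  ultimately have "log_mean_exp S y \<le> ln (exp b)"
    unfolding log_mean_exp_def using assms
    by (subst ln_le_cancel_iff) (auto simp: field_simps card_gt_0_iff)
  then show ?thesis by simp
qed

text \<open>A crude envelope, serving as the dominating function for integrability.\<close>

lemma abs_log_mean_exp_le:
  assumes "finite S" "S \<noteq> {}"
  shows "\<bar>log_mean_exp S y\<bar> \<le> (\<Sum>t\<in>S. \<bar>y t\<bar>)"
proof (rule abs_leI)
  have *: "\<bar>y t\<bar> \<le> (\<Sum>t\<in>S. \<bar>y t\<bar>)" if "t \<in> S" for t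
    using assms that by (intro member_le_sum) auto
  show "log_mean_exp S y \<le> (\<Sum>t\<in>S. \<bar>y t\<bar>)"
    by (rule log_mean_exp_le[OF assms]) (use * in fastforce)
  have "real (card S) \<ge> 1" using assms by (simp add: Suc_leI card_gt_0_iff)
  then have "1 / real (card S) * \<bar>\<Sum>t\<in>S. y t\<bar> \<le> 1 * (\<Sum>t\<in>S. \<bar>y t\<bar>)"
    by (intro mult_mono) (auto intro: sum_nonneg)
  moreover have "- (1 / real (card S) * \<bar>\<Sum>t\<in>S. y t\<bar>) \<le> 1 / real (card S) * (\<Sum>t\<in>S. y t)"
    by (smt (verit, best) mult_minus_right mult_left_mono of_nat_0_le_iff divide_nonneg_nonneg)
  ultimately show "- log_mean_exp S y \<le> (\<Sum>t\<in>S. \<bar>y t\<bar>)"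
    using mean_le_log_mean_exp[OF assms, of y] by linarith
qed

lemma log_mean_exp_le_mean_minus_1:
  assumes "finite S" "S \<noteq> {}"
  shows "log_mean_exp S y \<le> 1 / real (card S) * (\<Sum>t\<in>S. exp (y t)) - 1"
  unfolding log_mean_exp_def using assms by (intro ln_le_minus_one) (auto simp: card_gt_0_iff sum_pos)

lemma sum_sum_remove:
  fixes f :: "'i \<Rightarrow> real"
  assumes "finite S" "S \<noteq> {}"
  shows "(\<Sum>t\<in>S. \<Sum>u\<in>S - {t}. f u) = (real (card S) - 1) * (\<Sum>u\<in>S. f u)"
proof -
  have "(\<Sum>t\<in>S. \<Sum>u\<in>S - {t}. f u) = (\<Sum>t\<in>S. (\<Sum>u\<in>S. f u) - f t)"
    using assms by (intro sum.cong) (auto simp: sum_diff1)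
  then show ?thesis by (simp add: sum_subtractf algebra_simps)
qed

text \<open>Each point survives in \<open>card S - 1\<close> of the sets \<open>S - {t}\<close>, so
  the mean over \<open>S\<close> is the average of the leave-one-out means; then \<open>ln\<close>
  is concave.\<close>

lemma log_mean_exp_leave_one_out:
  assumes "finite S" "2 \<le> card S"
  shows "1 / real (card S) * (\<Sum>t\<in>S. log_mean_exp (S - {t}) y) \<le> log_mean_exp S y"
proof -
  define a where "a = (\<lambda>t. 1 / (real (card S) - 1) * (\<Sum>u\<in>S - {t}. exp (y u)))"
  have ne: "S \<noteq> {}" using assms by auto
  have pos: "0 < a t" if "t \<in> S" for t
  proof -
    have "card (S - {t}) \<noteq> 0" using assms that by simp
    then have "S - {t} \<noteq> {}" by (metis card.empty)
    then show ?thesis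
      unfolding a_def using assms by (intro mult_pos_pos sum_pos) auto
  qed
  have "log_mean_exp (S - {t}) y = ln (a t)" if "t \<in> S" for t
    using assms that by (simp add: log_mean_exp_def a_def)
  then have "1 / real (card S) * (\<Sum>t\<in>S. log_mean_exp (S - {t}) y)
      = 1 / real (card S) * (\<Sum>t\<in>S. ln (a t))" by simp
  also have "\<dots> \<le> ln (1 / real (card S) * (\<Sum>t\<in>S. a t))"
    by (rule mean_ln_le_ln_mean[OF assms(1) ne pos])
  also have "(\<Sum>t\<in>S. a t) = (\<Sum>t\<in>S. exp (y t))"
    using assms sum_sum_remove[OF assms(1) ne, of "\<lambda>u. exp (y u)"]
    by (simp add: a_def flip: sum_divide_distrib)
  finally show ?thesis by (simp add: log_mean_exp_def)
qed

text \<open>Factoring out the midpoint leaves a cosh of half the difference. For centered variables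
  the midpoint vanishes in expectation.\<close>

lemma log_mean_exp_pair:
  assumes "s \<noteq> t"
  shows "log_mean_exp {s, t} y = (y s + y t) / 2 + ln (cosh ((y s - y t) / 2))"
proof -
  have "exp ((y s + y t) / 2) * exp ((y s - y t) / 2) = exp (y s)"
    "exp ((y s + y t) / 2) * exp (- ((y s - y t) / 2)) = exp (y t)"
    unfolding exp_add[symmetric] by (simp_all add: field_simps)
  then have "1 / 2 * (exp (y s) + exp (y t)) = exp ((y s + y t) / 2) * cosh ((y s - y t) / 2)"
    by (simp add: cosh_field_def distrib_left)
  then show ?thesis
    using assms by (simp add: log_mean_exp_def ln_mult)
qed

section \<open>Lower bounds for ln cosh\<close>

lemma tanh_real_le_self:
  fixes x :: real assumes "0 \<le> x" shows "tanh x \<le> x"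
proof -
  have "(\<lambda>x. x - tanh x) 0 \<le> (\<lambda>x. x - tanh x) x"
  proof (rule DERIV_nonneg_imp_nondecreasing[OF assms])
    fix u :: real
    show "\<exists>y. ((\<lambda>x. x - tanh x) has_real_derivative y) (at u) \<and> 0 \<le> y"
      by (rule exI[of _ "tanh u ^ 2"]) (auto intro!: derivative_eq_intros)
  qed
  then show ?thesis by simp
qed

text \<open>The difference has derivative \<open>u ^ 2 - tanh u ^ 2\<close>, nonnegative by the
  linear bound on tanh.\<close>

lemma tanh_real_ge_cubic:
  fixes x :: real assumes "0 \<le> x" shows "x - x ^ 3 / 3 \<le> tanh x"
proof -
  have "(\<lambda>x. tanh x - x + x ^ 3 / 3) 0 \<le> (\<lambda>x. tanh x - x + x ^ 3 / 3) x"
  proof (rule DERIV_nonneg_imp_nondecreasing[OF assms])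
    fix u :: real assume u: "0 \<le> u"
    have "tanh u ^ 2 \<le> u ^ 2" using u tanh_real_le_self[OF u] by (intro power_mono) auto
    then show "\<exists>y. ((\<lambda>x. tanh x - x + x ^ 3 / 3) has_real_derivative y) (at u) \<and> 0 \<le> y"
      by (intro exI[of _ "u ^ 2 - tanh u ^ 2"]) (auto intro!: derivative_eq_intros)
  qed
  then show ?thesis by simp
qed

lemma has_real_derivative_ln_cosh:
  "((\<lambda>x. ln (cosh x)) has_real_derivative tanh u) (at u)"
  by (auto intro!: derivative_eq_intros simp: tanh_def)

text \<open>The cubic bound on tanh, integrated from 0 to \<bar>x\<bar>; both sides are
  even.\<close>

lemma ln_cosh_ge:
  fixes x :: real shows "x ^ 2 / 2 - x ^ 4 / 12 \<le> ln (cosh x)"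
proof -
  have "(\<lambda>x. ln (cosh x) - x ^ 2 / 2 + x ^ 4 / 12) 0 \<le> (\<lambda>x. ln (cosh x) - x ^ 2 / 2 + x ^ 4 / 12) \<bar>x\<bar>"
  proof (rule DERIV_nonneg_imp_nondecreasing[OF abs_ge_zero])
    fix u :: real assume u: "0 \<le> u"
    show "\<exists>y. ((\<lambda>x. ln (cosh x) - x ^ 2 / 2 + x ^ 4 / 12) has_real_derivative y) (at u) \<and> 0 \<le> y"
      using tanh_real_ge_cubic[OF u]
      by (intro exI[of _ "tanh u - u + u ^ 3 / 3"])
        (auto intro!: derivative_eq_intros simp: tanh_def[of u])
  qed
  then show ?thesis by simp
qed

text \<open>ln cosh is convex and vanishes at 0. The quartic bound degrades for large arguments;
  this inequality first shrinks the argument by a factor \<open>k\<close>.\<close>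

lemma ln_cosh_mult_ge:
  fixes x k :: real assumes k: "1 \<le> k" shows "k * ln (cosh x) \<le> ln (cosh (k * x))"
proof -
  have "(\<lambda>x. ln (cosh (k * x)) - k * ln (cosh x)) 0 \<le> (\<lambda>x. ln (cosh (k * x)) - k * ln (cosh x)) \<bar>x\<bar>"
  proof (rule DERIV_nonneg_imp_nondecreasing[OF abs_ge_zero])
    fix u :: real assume u: "0 \<le> u"
    have "((\<lambda>x. ln (cosh (k * x))) has_real_derivative (tanh (k * u) * k)) (at u)"
      by (rule DERIV_chain'[OF _ has_real_derivative_ln_cosh]) (auto intro!: derivative_eq_intros)
    then have "((\<lambda>x. ln (cosh (k * x)) - k * ln (cosh x)) has_real_derivative
        (tanh (k * u) * k - k * tanh u)) (at u)"
      by (intro DERIV_diff DERIV_cmult has_real_derivative_ln_cosh)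
    moreover have "tanh u \<le> tanh (k * u)"
      using k u mult_right_mono[of 1 k u] by simp
    then have "0 \<le> tanh (k * u) * k - k * tanh u"
      using k by (simp add: mult.commute)
    ultimately show "\<exists>y. ((\<lambda>x. ln (cosh (k * x)) - k * ln (cosh x)) has_real_derivative y) (at u) \<and> 0 \<le> y"
      by blast
  qed
  moreover have "cosh (k * \<bar>x\<bar>) = cosh (k * x)"
    using k cosh_real_abs[of "k * x"] by (simp add: abs_mult)
  ultimately show ?thesis by simp
qed

section \<open>The divergence of order 1/2 between Gibbs measures\<close>

text \<open>The square root of a Gibbs weight at \<beta> is an unnormalised weight at \<beta>/2, so
  the sum in the divergence is a partition function at \<beta>/2, and its prefactor is -2.\<close>

lemma renyi_half_gibbs:
  assumes "finite T" "T \<noteq> {}"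
  shows "renyi_divergence (1/2) T (gibbs T x \<beta>) (gibbs T x 0) =
    log_mean_exp T (\<lambda>t. \<beta> * x t) - 2 * log_mean_exp T (\<lambda>t. \<beta> / 2 * x t)"
proof -
  define Z where "Z = (\<lambda>\<beta>. \<Sum>t\<in>T. exp (\<beta> * x t))"
  define n where "n = real (card T)"
  have n: "0 < n" using assms by (simp add: n_def card_gt_0_iff)
  have Z: "0 < Z b" for b using assms by (simp add: Z_def sum_pos)
  have "gibbs T x \<beta> t powr (1/2) * gibbs T x 0 t powr (1 - 1/2)
      = exp (\<beta> / 2 * x t) / (sqrt (Z \<beta>) * sqrt n)" for t
  proof -
    have "gibbs T x \<beta> t powr (1/2) = exp (\<beta> / 2 * x t) / sqrt (Z \<beta>)"
    proof -
      have "gibbs T x \<beta> t = exp (\<beta> * x t) / Z \<beta>"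
        by (simp add: gibbs_def partition_function_def Z_def)
      moreover have "exp (\<beta> * x t) powr (1/2) = exp (\<beta> / 2 * x t)"
        by (simp add: powr_def)
      ultimately show ?thesis
        using Z[of \<beta>] by (simp add: powr_divide powr_half_sqrt less_imp_le)
    qed
    moreover have "gibbs T x 0 t powr (1 - 1/2) = 1 / sqrt n"
      using n by (simp add: gibbs_0 n_def[symmetric] powr_half_sqrt real_sqrt_divide)
    ultimately show ?thesis by simp
  qed
  then have "renyi_divergence (1/2) T (gibbs T x \<beta>) (gibbs T x 0) =
      -2 * ln (Z (\<beta> / 2) / (sqrt (Z \<beta>) * sqrt n))"
    by (simp add: renyi_divergence_def Z_def flip: sum_divide_distrib)
  also have "\<dots> = ln (Z \<beta> / n) - 2 * ln (Z (\<beta> / 2) / n)"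
    using n Z[of \<beta>] Z[of "\<beta> / 2"] by (simp add: ln_div ln_mult ln_sqrt)
  finally show ?thesis by (simp add: log_mean_exp_def Z_def n_def)
qed

text \<open>A sum of squares of positive terms is at most the square of their sum:
  \<open>Z \<beta> \<le> Z (\<beta> / 2) ^ 2\<close>. The normalisations leave one
  \<open>ln n\<close>.\<close>

lemma renyi_half_gibbs_le:
  assumes "finite T" "T \<noteq> {}"
  shows "log_mean_exp T (\<lambda>t. \<beta> * x t) - 2 * log_mean_exp T (\<lambda>t. \<beta> / 2 * x t) \<le> ln (real (card T))"
proof -
  define Z where "Z = (\<lambda>\<beta>. \<Sum>t\<in>T. exp (\<beta> * x t))"
  define n where "n = real (card T)"
  have n: "0 < n" using assms by (simp add: n_def card_gt_0_iff)
  have Z: "0 < Z b" for b using assms by (simp add: Z_def sum_pos)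
  have "Z \<beta> = (\<Sum>t\<in>T. exp (\<beta> / 2 * x t) * exp (\<beta> / 2 * x t))"
    by (simp add: Z_def flip: exp_add)
  also have "\<dots> \<le> (\<Sum>t\<in>T. exp (\<beta> / 2 * x t) * Z (\<beta> / 2))"
    unfolding Z_def using assms by (intro sum_mono mult_left_mono member_le_sum) auto
  also have "\<dots> = Z (\<beta> / 2) ^ 2"
    by (simp add: Z_def power2_eq_square flip: sum_distrib_right)
  finally have "ln (Z \<beta>) \<le> ln (Z (\<beta> / 2) ^ 2)"
    using Z by (intro ln_mono) auto
  then have "ln (Z \<beta>) \<le> 2 * ln (Z (\<beta> / 2))" using Z by (simp add: ln_realpow)
  have "log_mean_exp T (\<lambda>t. b * x t) = ln (Z b) - ln n" for b
    using n Z[of b] by (auto simp: log_mean_exp_def Z_def n_def ln_div)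
  from this[of \<beta>] this[of "\<beta> / 2"] show ?thesis
    using \<open>ln (Z \<beta>) \<le> 2 * ln (Z (\<beta> / 2))\<close> by (simp add: n_def)
qed

section \<open>The deterministic dichotomy\<close>

text \<open>Here \<open>b\<close> stands for \<beta>\<sigma> and \<open>G\<close> for the expected
  log-mean-exp. Both families of lower bounds have a free parameter, the subset size
  \<open>m\<close> or the contraction factor \<open>k\<close>, chosen according to the size of
  \<open>w = c * b\<close>.\<close>

lemma sudakov_scale_dichotomy:
  fixes b c G :: real and n :: nat
  assumes c: "0 < c" "c \<le> 3 / 4" and b: "0 < b" and n: "2 \<le> n"
    and sudakov: "\<And>m. 2 \<le> m \<Longrightarrow> m \<le> n \<Longrightarrow>
      sqrt 2 * c * b * sqrt (ln (real m)) - ln (real m) \<le> G"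
    and pair: "\<And>k. 1 \<le> k \<Longrightarrow> k * ((b / k) ^ 2 / 4 - (b / k) ^ 4 / 16) \<le> G"
  shows "c ^ 2 * b ^ 2 / 4 \<le> G \<or> c * b / 2 * sqrt (ln (real n)) \<le> G"
proof -
  define w where "w = c * b"
  define q where "q = (\<lambda>m::nat. sqrt (ln (real m)))"
  have w: "0 < w" using c b by (simp add: w_def)
  have q0: "0 \<le> q m" if "1 \<le> m" for m using that by (simp add: q_def)
  have q2: "q m ^ 2 = ln (real m)" if "1 \<le> m" for m using that by (simp add: q_def)
  \<comment> \<open>The Sudakov bound as a quadratic in \<open>q m\<close>, with
    \<open>sqrt 2\<close> rounded down to 7/5.\<close>
  have low: "q m * (7 / 5 * w - q m) \<le> G" if "2 \<le> m" "m \<le> n" for m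
  proof -
    have "7 / 5 \<le> sqrt 2" by (rule real_le_rsqrt) (simp add: power2_eq_square)
    then have "7 / 5 * (w * q m) \<le> sqrt 2 * (w * q m)"
      using w q0[of m] that by (intro mult_right_mono) auto
    then have "q m * (7 / 5 * w - q m) \<le> sqrt 2 * (w * q m) - q m ^ 2"
      by (simp add: algebra_simps power2_eq_square)
    also have "\<dots> \<le> G"
      using sudakov[OF that] q2[of m] that by (simp add: w_def q_def mult_ac)
    finally show ?thesis .
  qed
  \<comment> \<open>The roots of \<open>x (7/5 w - x) = w\<^sup>2/4\<close> are about \<open>0.21 w\<close> and \<open>1.19 w\<close>; the window is wide enough
    to contain some \<open>q m\<close>, as \<open>q m \<le> 2 q (m - 1)\<close> for \<open>m \<ge> 3\<close>.\<close>
  have window: "w ^ 2 / 4 \<le> G" if "2 \<le> m" "m \<le> n" "w / 4 \<le> q m" "q m \<le> 11 / 10 * w" for m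
  proof -
    have "0 \<le> (q m - w / 4) * (11 / 10 * w - q m)" using that by simp
    moreover have "0 \<le> q m * w" using w q0[of m] that by simp
    moreover have "0 \<le> w ^ 2" by simp
    \<comment> \<open>The coefficients match since 7/5 = 1/4 + 11/10 + 1/20; the leftover 11/40
      exceeds 1/4.\<close>
    moreover have "q m * (7 / 5 * w - q m)
        = (q m - w / 4) * (11 / 10 * w - q m) + q m * w / 20 + 11 / 40 * w ^ 2"
      by (simp add: field_simps power2_eq_square)
    ultimately show ?thesis using low[OF that(1,2)] by linarith
  qed
  show ?thesis
  proof (cases "q n \<le> 9 / 10 * w")
    case True
    \<comment> \<open>Taking \<open>m = n\<close>, the factor is at least (7/5 - 9/10) w = w/2,
      which yields the second alternative.\<close>
    have "q n * (w / 2) \<le> q n * (7 / 5 * w - q n)"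
      using True q0[of n] n by (intro mult_left_mono) auto
    then have "w / 2 * q n \<le> G" using low[of n] n by (simp add: mult.commute)
    then show ?thesis by (simp add: w_def q_def)
  next
    case False
    \<comment> \<open>The first size whose \<open>q\<close> enters the window from below;
      \<open>n\<close> is a candidate because \<open>q n > 9 / 10 * w\<close>. Minimality prevents
      overshooting unless \<open>m = 2\<close>, which has no admissible predecessor.\<close>
    define m where "m = (LEAST m. 2 \<le> m \<and> w / 4 \<le> q m)"
    have ex: "2 \<le> n \<and> w / 4 \<le> q n" using False w n by simp
    have m: "2 \<le> m" "w / 4 \<le> q m" using LeastI[of "\<lambda>m. 2 \<le> m \<and> w / 4 \<le> q m", OF ex] by (auto simp: m_def)
    have mn: "m \<le> n" unfolding m_def using ex by (rule Least_le)
    have "w ^ 2 / 4 \<le> G"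
    proof (cases "q m \<le> 11 / 10 * w")
      case True
      then show ?thesis using window m mn by blast
    next
      case big: False
      have "m = 2"
      proof (rule ccontr)
        assume "m \<noteq> 2"
        then have m3: "3 \<le> m" using m by simp
        have "\<not> (2 \<le> m - 1 \<and> w / 4 \<le> q (m - 1))"
          using not_less_Least[of "m - 1" "\<lambda>m. 2 \<le> m \<and> w / 4 \<le> q m"] m3 by (simp add: m_def)
        moreover have "2 \<le> m - 1" using m3 by linarith
        ultimately have less: "q (m - 1) < w / 4" by linarith
        \<comment> \<open>Hence \<open>ln m\<close> is at most twice \<open>ln (m - 1)\<close>, and
          \<open>q m \<le> 2 * q (m - 1) < w / 2\<close>, below the upper end of the window.\<close>
        have "real m \<le> (real m - 1) ^ 2"
        proof -
          have "0 \<le> (real m - 3) * real m" using m3 by simp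
          then show ?thesis by (simp add: power2_eq_square algebra_simps)
        qed
        then have "ln (real m) \<le> ln ((real m - 1) ^ 2)" using m3 by (intro ln_mono) auto
        then have "q m ^ 2 \<le> 2 * q (m - 1) ^ 2"
          using m3 q2[of m] q2[of "m - 1"] by (simp add: ln_realpow of_nat_diff)
        also have "\<dots> \<le> (2 * q (m - 1)) ^ 2" by (simp add: power_mult_distrib)
        finally have "q m \<le> 2 * q (m - 1)" by (rule power2_le_imp_le) (use q0 m3 in auto)
        then show False using less big w by linarith
      qed
      \<comment> \<open>From ln 2 \<le> 25/36. Since \<open>q 2\<close> overshoots the window,
        \<open>w\<close> is small, and the two-point bound takes over.\<close>
      moreover have "q 2 \<le> 5 / 6"
        unfolding q_def using ln2_le_25_over_36 by (intro real_le_lsqrt) (auto simp: power2_eq_square)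
      ultimately have wb: "w \<le> 10 / 11 * (5 / 6)" using big by auto
      show ?thesis
      \<comment> \<open>The choice is \<open>k = max 1 b\<close>. For \<open>k = 1\<close>,
        \<open>c ^ 2 \<le> 9 / 16\<close> is below \<open>1 - b ^ 2 / 4\<close>. For
        \<open>k = b\<close> the two-point bound equals b (1/4 - 1/16) = 3b/16, and
        \<open>c * w \<le> 3 / 4\<close> suffices.\<close>
      proof (cases "b \<le> 1")
        case True
        have "b ^ 2 \<le> 1" "c ^ 2 \<le> 9 / 16"
          using True b c power_mono[of b 1 2] power_mono[of c "3 / 4" 2] by (auto simp: power2_eq_square)
        then have "c ^ 2 \<le> 1 - b ^ 2 / 4" by linarith
        then have "b ^ 2 * c ^ 2 \<le> b ^ 2 * (1 - b ^ 2 / 4)" by (rule mult_left_mono) simp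
        then have "w ^ 2 / 4 \<le> b ^ 2 / 4 - b ^ 4 / 16"
          by (simp add: w_def power_mult_distrib algebra_simps flip: power_add)
        then show ?thesis using pair[of 1] by simp
      next
        case False
        have "c * w \<le> 3 / 4 * (10 / 11 * (5 / 6))" using c w wb by (intro mult_mono) auto
        then have "b * (c * w) \<le> b * (3 / 4)" using b by (intro mult_left_mono) auto
        then have "w ^ 2 / 4 \<le> b * (3 / 16)"
          by (simp add: w_def power2_eq_square algebra_simps)
        then show ?thesis using pair[of b] False b by simp
      qed
    qed
    then show ?thesis by (simp add: w_def power_mult_distrib)
  qed
qed

section \<open>The i.i.d. Gaussian family and Sudakov minoration\<close>

locale iid_centered_gaussian = prob_space M
  for M :: "'w measure" and T :: "'i set" and X :: "'i \<Rightarrow> 'w \<Rightarrow> real" and \<sigma> :: real +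
  assumes fin: "finite T" and \<sigma>_pos: "0 < \<sigma>"
    and indep: "indep_vars (\<lambda>_. borel) X T"
    and normal: "\<And>t. t \<in> T \<Longrightarrow> distributed M lborel (X t) (normal_density 0 \<sigma>)"
begin

lemma measurable_X: "t \<in> T \<Longrightarrow> X t \<in> borel_measurable M"
  using distributed_measurable[OF normal] by simp

lemma integrable_X: "t \<in> T \<Longrightarrow> integrable M (X t)"
  using distributed_integrable[OF normal, of t "\<lambda>x. x"] integrable_normal_moment_nz_1[OF \<sigma>_pos, of 0]
  by simp

lemma expectation_X: "t \<in> T \<Longrightarrow> expectation (X t) = 0"
  by (rule normal_distributed_expectation[OF \<sigma>_pos normal])

lemma centered_gaussian_process_subset:
  assumes "S \<subseteq> T" shows "centered_gaussian_process M S X"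
  unfolding centered_gaussian_process_def
proof (intro conjI allI ballI impI)
  show "prob_space M" by (rule prob_space_axioms)
  show "expectation (X t) = 0" if "t \<in> S" for t using that assms expectation_X by blast
next
  fix F and a :: "'i \<Rightarrow> real" assume F: "finite F \<and> F \<subseteq> S"
  \<comment> \<open>The sum rule for independent normals requires positive variances, so zero
    coefficients are dropped. If none remain, the sum is constant, the degenerate case of
    \<open>gaussian_rv\<close>.\<close>
  define F' where "F' = {t \<in> F. a t \<noteq> 0}"
  have F': "finite F'" "F' \<subseteq> T" using F assms by (auto simp: F'_def)
  have eq: "(\<Sum>t\<in>F. a t * X t \<omega>) = (\<Sum>t\<in>F'. a t * X t \<omega>)" for \<omega>
    using F by (intro sum.mono_neutral_right) (auto simp: F'_def)
  show "gaussian_rv M (\<lambda>\<omega>. \<Sum>t\<in>F. a t * X t \<omega>)"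
  proof (cases "F' = {}")
    case True
    then show ?thesis by (auto simp: gaussian_rv_def eq)
  next
    case False
    have "indep_vars (\<lambda>_. borel) (\<lambda>t. (\<lambda>x. a t * x) \<circ> X t) F'"
      by (rule indep_vars_compose[OF indep_vars_subset[OF indep F'(2)]]) auto
    then have ind: "indep_vars (\<lambda>_. borel) (\<lambda>t \<omega>. a t * X t \<omega>) F'" by (simp add: comp_def)
    have dis: "distributed M lborel (\<lambda>\<omega>. a t * X t \<omega>) (normal_density 0 (\<bar>a t\<bar> * \<sigma>))" if "t \<in> F'" for t
      using normal_density_affine[OF normal \<sigma>_pos, of t "a t" 0] that F' by (auto simp: F'_def)
    have "distributed M lborel (\<lambda>\<omega>. \<Sum>t\<in>F'. a t * X t \<omega>)
        (normal_density (\<Sum>t\<in>F'. 0) (sqrt (\<Sum>t\<in>F'. (\<bar>a t\<bar> * \<sigma>)\<^sup>2)))"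
      by (rule sum_indep_normal[OF F'(1) False ind _ dis]) (use \<sigma>_pos in \<open>auto simp: F'_def\<close>)
    moreover have "0 < sqrt (\<Sum>t\<in>F'. (\<bar>a t\<bar> * \<sigma>)\<^sup>2)"
      using F' False \<sigma>_pos by (auto intro!: sum_pos simp: F'_def)
    moreover have "(\<lambda>\<omega>. \<Sum>t\<in>F'. a t * X t \<omega>) \<in> borel_measurable M"
      using F' measurable_X by (intro borel_measurable_sum borel_measurable_times) auto
    ultimately show ?thesis unfolding gaussian_rv_def eq by auto
  qed
qed

lemma distributed_diff:
  assumes "s \<in> T" "t \<in> T" "s \<noteq> t"
  shows "distributed M lborel (\<lambda>\<omega>. X s \<omega> - X t \<omega>) (normal_density 0 (sqrt 2 * \<sigma>))"
proof -
  \<comment> \<open>Independence of \<open>X s\<close> from a sum over the singleton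
    \<open>{t}\<close>.\<close>
  have "indep_var borel (X s) borel (X t)"
    using indep_vars_sum[of "{t}" s X] indep_vars_subset[OF indep] assms by simp
  from diff_indep_normal[OF this \<sigma>_pos \<sigma>_pos normal normal] assms
  have "distributed M lborel (\<lambda>\<omega>. X s \<omega> - X t \<omega>) (normal_density (0 - 0) (sqrt (\<sigma>\<^sup>2 + \<sigma>\<^sup>2)))" by blast
  moreover have "sqrt (\<sigma>\<^sup>2 + \<sigma>\<^sup>2) = sqrt 2 * \<sigma>"
    using \<sigma>_pos by (simp add: real_sqrt_mult flip: mult_2)
  ultimately show ?thesis by simp
qed

lemma diff_even_moment:
  assumes "s \<in> T" "t \<in> T" "s \<noteq> t"
  shows "integrable M (\<lambda>\<omega>. (X s \<omega> - X t \<omega>) ^ (2 * k))"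
    and "expectation (\<lambda>\<omega>. (X s \<omega> - X t \<omega>) ^ (2 * k)) = fact (2 * k) / fact k * \<sigma> ^ (2 * k)"
proof -
  have \<tau>: "0 < sqrt 2 * \<sigma>" using \<sigma>_pos by simp
  note D = distributed_diff[OF assms]
  show "integrable M (\<lambda>\<omega>. (X s \<omega> - X t \<omega>) ^ (2 * k))"
    using distributed_integrable[OF D, of "\<lambda>x. x ^ (2 * k)"]
      integrable_normal_moment[OF \<tau>, of 0 "2 * k"] by simp
  have "expectation (\<lambda>\<omega>. (X s \<omega> - X t \<omega>) ^ (2 * k)) = fact (2 * k) / ((2 / (sqrt 2 * \<sigma>)\<^sup>2) ^ k * fact k)"
    using distributed_integral[OF D, of "\<lambda>x. x ^ (2 * k)"]
      integral_normal_moment_even[OF \<tau>, of 0 k] by simp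
  also have "\<dots> = fact (2 * k) / fact k * \<sigma> ^ (2 * k)"
    by (simp add: power_mult_distrib power_divide power_mult)
  finally show "expectation (\<lambda>\<omega>. (X s \<omega> - X t \<omega>) ^ (2 * k)) = fact (2 * k) / fact k * \<sigma> ^ (2 * k)" .
qed

text \<open>By independence, distinct points all have L2 distance \<open>sqrt 2 * \<sigma>\<close>,
  so every subset has the same separation.\<close>

lemma sudakov:
  assumes c: "sudakov_constant c" and S: "S \<subseteq> T" "2 \<le> card S"
  shows "c * (sqrt 2 * \<sigma>) * sqrt (ln (real (card S))) \<le> expectation (\<lambda>\<omega>. Max ((\<lambda>t. X t \<omega>) ` S))"
proof (rule sudakov_constantD[OF c _ S(2) centered_gaussian_process_subset[OF S(1)]])
  show "finite S" using S fin finite_subset by blast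
  show "0 < sqrt 2 * \<sigma>" using \<sigma>_pos by simp
  show "sqrt 2 * \<sigma> \<le> sqrt (expectation (\<lambda>\<omega>. \<bar>X s \<omega> - X t \<omega>\<bar>\<^sup>2))"
    if "s \<in> S" "t \<in> S" "s \<noteq> t" for s t
  proof -
    have "s \<in> T" "t \<in> T" using that S by auto
    then show ?thesis
      using diff_even_moment(2)[of s t 1] that(3) \<sigma>_pos by (simp add: real_sqrt_mult)
  qed
qed

lemma integrable_Max_X:
  assumes "S \<subseteq> T" "S \<noteq> {}"
  shows "integrable M (\<lambda>\<omega>. Max ((\<lambda>t. X t \<omega>) ` S))"
proof (rule Bochner_Integration.integrable_bound)
  have S: "finite S" using assms fin finite_subset by blast
  show "integrable M (\<lambda>\<omega>. \<Sum>t\<in>S. \<bar>X t \<omega>\<bar>)"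
    using assms by (intro Bochner_Integration.integrable_sum integrable_abs integrable_X) auto
  show "(\<lambda>\<omega>. Max ((\<lambda>t. X t \<omega>) ` S)) \<in> borel_measurable M"
    using S assms measurable_X by (intro borel_measurable_Max) auto
  show "AE \<omega> in M. norm (Max ((\<lambda>t. X t \<omega>) ` S)) \<le> norm (\<Sum>t\<in>S. \<bar>X t \<omega>\<bar>)"
  proof (rule AE_I2)
    fix \<omega>
    have "Max ((\<lambda>t. X t \<omega>) ` S) \<in> (\<lambda>t. X t \<omega>) ` S" using S assms by (intro Max_in) auto
    then obtain t where "t \<in> S" "Max ((\<lambda>t. X t \<omega>) ` S) = X t \<omega>" by auto
    moreover have "\<bar>X t \<omega>\<bar> \<le> (\<Sum>t\<in>S. \<bar>X t \<omega>\<bar>)" if "t \<in> S" for t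
      using that S member_le_sum[of t S "\<lambda>t. \<bar>X t \<omega>\<bar>"] by auto
    ultimately show "norm (Max ((\<lambda>t. X t \<omega>) ` S)) \<le> norm (\<Sum>t\<in>S. \<bar>X t \<omega>\<bar>)" by force
  qed
qed

text \<open>Sudakov minoration is tested on two points. With \<open>k\<close> the standard deviation
  of the difference, the expected maximum is at most \<open>k / 2\<close>, so
  \<open>c * sqrt (ln 2) \<le> 1 / 2\<close>, while \<open>sqrt (ln 2) \<ge> 2 / 3\<close>.\<close>

lemma sudakov_constant_le:
  assumes c: "sudakov_constant c" and st: "s \<in> T" "t \<in> T" "s \<noteq> t"
  shows "c \<le> 3 / 4"
proof -
  define k where "k = sqrt 2 * \<sigma>"
  have k: "0 < k" "k ^ 2 = 2 * \<sigma> ^ 2" using \<sigma>_pos by (simp_all add: k_def power_mult_distrib)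
  have int: "integrable M (\<lambda>\<omega>. (X s \<omega> - X t \<omega>) ^ 2)"
    using diff_even_moment(1)[OF st, of 1] by simp
  have ptw: "Max ((\<lambda>t. X t \<omega>) ` {s, t}) \<le>
      (X s \<omega> + X t \<omega>) / 2 + ((X s \<omega> - X t \<omega>) ^ 2 / k + k) / 4" for \<omega>
  proof -
    define e where "e = (X s \<omega> - X t \<omega>) ^ 2 / k"
    \<comment> \<open>Young's inequality replaces the absolute difference by its square, whose
      expectation is \<open>k ^ 2\<close>.\<close>
    have "0 \<le> (\<bar>X s \<omega> - X t \<omega>\<bar> - k) ^ 2 / k" using k by simp
    also have "\<dots> = e + k - 2 * \<bar>X s \<omega> - X t \<omega>\<bar>"
      using k(1) by (simp add: e_def power2_diff add_divide_distrib diff_divide_distrib) (simp add: power2_eq_square)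
    finally have "2 * \<bar>X s \<omega> - X t \<omega>\<bar> \<le> e + k" by simp
    moreover have "max (X s \<omega>) (X t \<omega>) = (X s \<omega> + X t \<omega>) / 2 + \<bar>X s \<omega> - X t \<omega>\<bar> / 2"
      by (simp add: max_def abs_if field_simps)
    ultimately have "max (X s \<omega>) (X t \<omega>) \<le> (X s \<omega> + X t \<omega>) / 2 + (e + k) / 4"
      by (simp add: field_simps)
    then show ?thesis by (simp add: e_def)
  qed
  have "c * k * sqrt (ln 2) \<le> expectation (\<lambda>\<omega>. Max ((\<lambda>t. X t \<omega>) ` {s, t}))"
    using sudakov[OF c, of "{s, t}"] st by (simp add: k_def)
  also have "\<dots> \<le> expectation (\<lambda>\<omega>. (X s \<omega> + X t \<omega>) / 2 + ((X s \<omega> - X t \<omega>) ^ 2 / k + k) / 4)"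
    using ptw st int
    by (intro integral_mono integrable_Max_X Bochner_Integration.integrable_add
        integrable_divide integrable_X integrable_const) auto
  also have "\<dots> = (expectation (X s) + expectation (X t)) / 2 +
      (expectation (\<lambda>\<omega>. (X s \<omega> - X t \<omega>) ^ 2) / k + k) / 4"
    using st int integrable_X by (simp add: prob_space)
  also have "\<dots> = (k ^ 2 / k + k) / 4"
    using diff_even_moment(2)[OF st, of 1] st by (simp add: expectation_X k(2))
  also have "\<dots> = k * (1 / 2)" using k(1) by (simp add: power2_eq_square)
  finally have "k * (c * sqrt (ln 2)) \<le> k * (1 / 2)" by (simp add: mult_ac)
  then have *: "c * sqrt (ln 2) \<le> 1 / 2" using k by simp
  have "2 / 3 \<le> sqrt (ln 2)"
    using ln2_ge_two_thirds by (intro real_le_rsqrt) (auto simp: power2_eq_square)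
  show ?thesis
  proof (rule ccontr)
    assume "\<not> c \<le> 3 / 4"
    then have "3 / 4 * (2 / 3) < c * sqrt (ln 2)"
      using \<open>2 / 3 \<le> sqrt (ln 2)\<close> by (intro mult_less_le_imp_less) auto
    then show False using * by simp
  qed
qed

section \<open>Lower bounds for the expected log-mean-exp\<close>

lemma integrable_log_mean_exp:
  assumes "S \<subseteq> T" "S \<noteq> {}"
  shows "integrable M (\<lambda>\<omega>. log_mean_exp S (\<lambda>t. \<beta> * X t \<omega>))"
proof (rule Bochner_Integration.integrable_bound)
  have S: "finite S" using assms fin finite_subset by blast
  show "integrable M (\<lambda>\<omega>. \<Sum>t\<in>S. \<bar>\<beta> * X t \<omega>\<bar>)"
    using assms by (intro Bochner_Integration.integrable_sum integrable_abs integrable_mult_right integrable_X) auto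
  show "(\<lambda>\<omega>. log_mean_exp S (\<lambda>t. \<beta> * X t \<omega>)) \<in> borel_measurable M"
    unfolding log_mean_exp_def using assms measurable_X
    by (intro borel_measurable_ln borel_measurable_times borel_measurable_sum
        borel_measurable_const borel_measurable_exp[THEN measurable_compose[rotated]]) auto
  show "AE \<omega> in M. norm (log_mean_exp S (\<lambda>t. \<beta> * X t \<omega>)) \<le> norm (\<Sum>t\<in>S. \<bar>\<beta> * X t \<omega>\<bar>)"
    using abs_log_mean_exp_le[OF S assms(2)] by (intro AE_I2) (fastforce intro: order_trans)
qed

lemma expectation_log_mean_exp_nonneg:
  assumes "S \<subseteq> T" "S \<noteq> {}"
  shows "0 \<le> expectation (\<lambda>\<omega>. log_mean_exp S (\<lambda>t. \<beta> * X t \<omega>))"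
proof -
  have S: "finite S" using assms fin finite_subset by blast
  have "0 = expectation (\<lambda>\<omega>. 1 / real (card S) * (\<Sum>t\<in>S. \<beta> * X t \<omega>))"
    using assms integrable_X expectation_X by (subst integral_mult_right_zero, subst Bochner_Integration.integral_sum) (auto intro!: sum.neutral)
  also have "\<dots> \<le> expectation (\<lambda>\<omega>. log_mean_exp S (\<lambda>t. \<beta> * X t \<omega>))"
    using assms integrable_X mean_le_log_mean_exp[OF S assms(2)]
    by (intro integral_mono integrable_log_mean_exp integrable_mult_right Bochner_Integration.integrable_sum) auto
  finally show ?thesis .
qed

text \<open>Induction on the cardinality upwards from \<open>m\<close>, averaging over leave-one-out
  subsets. A bound \<open>K\<close> uniform over all subsets of size \<open>m\<close> spares an
  appeal to exchangeability.\<close>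

lemma expectation_log_mean_exp_mono:
  assumes "m \<le> card S" "1 \<le> m" "S \<subseteq> T"
    and K: "\<And>R. R \<subseteq> T \<Longrightarrow> card R = m \<Longrightarrow> K \<le> expectation (\<lambda>\<omega>. log_mean_exp R (\<lambda>t. \<beta> * X t \<omega>))"
  shows "K \<le> expectation (\<lambda>\<omega>. log_mean_exp S (\<lambda>t. \<beta> * X t \<omega>))"
proof -
  have "K \<le> expectation (\<lambda>\<omega>. log_mean_exp S (\<lambda>t. \<beta> * X t \<omega>))"
    if "m \<le> n" "card S = n" "S \<subseteq> T" for n S
    using that
  proof (induction n arbitrary: S rule: nat_induct_at_least)
    case base
    then show ?case using K[of S] by simp
  next
    case (Suc n)
    have S: "finite S" using Suc.prems fin finite_subset by blast
    have card: "2 \<le> card S" using Suc.prems Suc.hyps assms(2) by simp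
    have ne: "S - {t} \<noteq> {}" "S - {t} \<subseteq> T" for t
      using card Suc.prems by (auto simp: subset_singleton_iff card_insert_if)
    have "K \<le> expectation (\<lambda>\<omega>. log_mean_exp (S - {t}) (\<lambda>t. \<beta> * X t \<omega>))" if "t \<in> S" for t
      using Suc.IH[of "S - {t}"] Suc.prems S that
      by (fastforce simp: card_Diff_singleton)
    then have "real (card S) * K \<le> (\<Sum>t\<in>S. expectation (\<lambda>\<omega>. log_mean_exp (S - {t}) (\<lambda>t. \<beta> * X t \<omega>)))"
      using sum_bounded_below[of S K] by simp
    then have "K \<le> 1 / real (card S) * (\<Sum>t\<in>S. expectation (\<lambda>\<omega>. log_mean_exp (S - {t}) (\<lambda>t. \<beta> * X t \<omega>)))"
      using card by (simp add: field_simps)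
    also have "\<dots> = expectation (\<lambda>\<omega>. 1 / real (card S) * (\<Sum>t\<in>S. log_mean_exp (S - {t}) (\<lambda>t. \<beta> * X t \<omega>)))"
      using integrable_log_mean_exp[OF ne(2,1)]
      by (subst integral_mult_right_zero, subst Bochner_Integration.integral_sum) auto
    also have "\<dots> \<le> expectation (\<lambda>\<omega>. log_mean_exp S (\<lambda>t. \<beta> * X t \<omega>))"
      using ne Suc.prems card log_mean_exp_leave_one_out[OF S card]
      by (intro integral_mono integrable_mult_right Bochner_Integration.integrable_sum integrable_log_mean_exp) auto
    finally show ?case .
  qed
  then show ?thesis using assms by blast
qed

text \<open>On a subset of size \<open>m\<close>, Sudakov bounds the expected maximum and passing to
  the log-mean-exp costs \<open>ln m\<close>. Keeping \<open>m\<close> free allows balancing gain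
  against cost.\<close>

lemma expectation_log_mean_exp_ge_sudakov:
  assumes c: "sudakov_constant c" and m: "2 \<le> m" "m \<le> card T" and \<beta>: "0 \<le> \<beta>"
  shows "sqrt 2 * c * (\<beta> * \<sigma>) * sqrt (ln (real m)) - ln (real m) \<le>
    expectation (\<lambda>\<omega>. log_mean_exp T (\<lambda>t. \<beta> * X t \<omega>))"
proof (rule expectation_log_mean_exp_mono[OF m(2)])
  fix R assume R: "R \<subseteq> T" "card R = m"
  have fR: "finite R" "R \<noteq> {}" using R fin finite_subset m by auto
  have eq: "Max ((\<lambda>t. \<beta> * X t \<omega>) ` R) = \<beta> * Max ((\<lambda>t. X t \<omega>) ` R)" for \<omega>
    using mono_Max_commute[of "\<lambda>x. \<beta> * x" "(\<lambda>t. X t \<omega>) ` R"] fR \<beta>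
    by (simp add: mono_def mult_left_mono image_image)
  have "\<beta> * (c * (sqrt 2 * \<sigma>) * sqrt (ln (real (card R)))) \<le> \<beta> * expectation (\<lambda>\<omega>. Max ((\<lambda>t. X t \<omega>) ` R))"
    using sudakov[OF c R(1)] R m \<beta> by (intro mult_left_mono) auto
  then have "sqrt 2 * c * (\<beta> * \<sigma>) * sqrt (ln (real m)) - ln (real m)
      \<le> \<beta> * expectation (\<lambda>\<omega>. Max ((\<lambda>t. X t \<omega>) ` R)) - ln (real m)"
    using R by (simp add: mult_ac)
  also have "\<dots> = expectation (\<lambda>\<omega>. \<beta> * Max ((\<lambda>t. X t \<omega>) ` R) - ln (real m))"
    using integrable_Max_X[OF R(1) fR(2)] by (simp add: prob_space)
  also have "\<dots> \<le> expectation (\<lambda>\<omega>. log_mean_exp R (\<lambda>t. \<beta> * X t \<omega>))"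
    using integrable_Max_X[OF R(1) fR(2)] Max_diff_ln_card_le_log_mean_exp[OF fR] R fR
    by (intro integral_mono integrable_log_mean_exp Bochner_Integration.integrable_diff integrable_mult_right)
      (auto simp flip: eq)
  finally show "sqrt 2 * c * (\<beta> * \<sigma>) * sqrt (ln (real m)) - ln (real m)
      \<le> expectation (\<lambda>\<omega>. log_mean_exp R (\<lambda>t. \<beta> * X t \<omega>))" .
qed (use m in auto)

text \<open>On two points the log-mean-exp is a centered midpoint plus a ln cosh of the difference.
  The argument is contracted by \<open>k\<close>, then the quartic bound is integrated using the
  moments 2\<sigma>^2 and 12\<sigma>^4.\<close>

lemma expectation_log_mean_exp_ge_pair:
  assumes card: "2 \<le> card T" and k: "1 \<le> k"
  shows "k * ((\<beta> * \<sigma> / k) ^ 2 / 4 - (\<beta> * \<sigma> / k) ^ 4 / 16) \<le>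
    expectation (\<lambda>\<omega>. log_mean_exp T (\<lambda>t. \<beta> * X t \<omega>))"
proof (rule expectation_log_mean_exp_mono[OF card])
  fix R assume R: "R \<subseteq> T" "card R = 2"
  then obtain s t where st: "R = {s, t}" "s \<noteq> t" by (auto simp: card_2_iff)
  then have T: "s \<in> T" "t \<in> T" using R by auto
  define d where "d = (\<lambda>\<omega>. X s \<omega> - X t \<omega>)"
  define u where "u = \<beta> / k / 2"
  have int: "integrable M (\<lambda>\<omega>. d \<omega> ^ 2)" "integrable M (\<lambda>\<omega>. d \<omega> ^ 4)"
    using diff_even_moment(1)[OF T st(2), of 1] diff_even_moment(1)[OF T st(2), of 2] by (simp_all add: d_def)
  have E: "expectation (\<lambda>\<omega>. d \<omega> ^ 2) = 2 * \<sigma> ^ 2" "expectation (\<lambda>\<omega>. d \<omega> ^ 4) = 12 * \<sigma> ^ 4"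
    using diff_even_moment(2)[OF T st(2), of 1] diff_even_moment(2)[OF T st(2), of 2]
    by (simp_all add: d_def fact_numeral)
  have ptw: "\<beta> / 2 * (X s \<omega> + X t \<omega>) + k * (u ^ 2 / 2 * d \<omega> ^ 2 - u ^ 4 / 12 * d \<omega> ^ 4)
      \<le> log_mean_exp R (\<lambda>t. \<beta> * X t \<omega>)" for \<omega>
  proof -
    have "k * (u ^ 2 / 2 * d \<omega> ^ 2 - u ^ 4 / 12 * d \<omega> ^ 4) \<le> k * ln (cosh (u * d \<omega>))"
      using ln_cosh_ge[of "u * d \<omega>"] k by (intro mult_left_mono) (auto simp: power_mult_distrib)
    also have "\<dots> \<le> ln (cosh (k * (u * d \<omega>)))" by (rule ln_cosh_mult_ge[OF k])
    also have "k * (u * d \<omega>) = (\<beta> * X s \<omega> - \<beta> * X t \<omega>) / 2"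
      using k by (simp add: u_def d_def right_diff_distrib)
    finally have "k * (u ^ 2 / 2 * d \<omega> ^ 2 - u ^ 4 / 12 * d \<omega> ^ 4)
        \<le> ln (cosh ((\<beta> * X s \<omega> - \<beta> * X t \<omega>) / 2))" .
    moreover have "\<beta> / 2 * (X s \<omega> + X t \<omega>) = (\<beta> * X s \<omega> + \<beta> * X t \<omega>) / 2"
      by (simp add: distrib_left)
    ultimately show ?thesis
      unfolding st(1) log_mean_exp_pair[OF st(2)] by linarith
  qed
  have "k * ((\<beta> * \<sigma> / k) ^ 2 / 4 - (\<beta> * \<sigma> / k) ^ 4 / 16) =
      \<beta> / 2 * (expectation (X s) + expectation (X t)) +
      k * (u ^ 2 / 2 * expectation (\<lambda>\<omega>. d \<omega> ^ 2) - u ^ 4 / 12 * expectation (\<lambda>\<omega>. d \<omega> ^ 4))"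
    using T by (simp add: expectation_X E u_def power_divide power_mult_distrib)
  also have "\<dots> = expectation (\<lambda>\<omega>. \<beta> / 2 * (X s \<omega> + X t \<omega>) + k * (u ^ 2 / 2 * d \<omega> ^ 2 - u ^ 4 / 12 * d \<omega> ^ 4))"
    using int T integrable_X by simp
  also have "\<dots> \<le> expectation (\<lambda>\<omega>. log_mean_exp R (\<lambda>t. \<beta> * X t \<omega>))"
    using int T R st ptw integrable_X by (intro integral_mono integrable_log_mean_exp) auto
  finally show "k * ((\<beta> * \<sigma> / k) ^ 2 / 4 - (\<beta> * \<sigma> / k) ^ 4 / 16) \<le>
    expectation (\<lambda>\<omega>. log_mean_exp R (\<lambda>t. \<beta> * X t \<omega>))" .
qed auto

section \<open>The free energy at zero\<close>

lemma expectation_exp_X: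
  assumes "t \<in> T"
  shows "integrable M (\<lambda>\<omega>. exp (\<beta> * X t \<omega>))"
    and "expectation (\<lambda>\<omega>. exp (\<beta> * X t \<omega>)) = exp (\<beta>\<^sup>2 * \<sigma>\<^sup>2 / 2)"
proof -
  \<comment> \<open>Completing the square: exponential tilting shifts the mean to
    \<beta>\<sigma>^2.\<close>
  have eq: "normal_density 0 \<sigma> x * exp (\<beta> * x) = exp (\<beta>\<^sup>2 * \<sigma>\<^sup>2 / 2) * normal_density (\<beta> * \<sigma>\<^sup>2) \<sigma> x" for x
  proof -
    have "- (x\<^sup>2 / (2 * \<sigma>\<^sup>2)) + \<beta> * x = \<beta>\<^sup>2 * \<sigma>\<^sup>2 / 2 + - ((x - \<beta> * \<sigma>\<^sup>2)\<^sup>2 / (2 * \<sigma>\<^sup>2))"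
      using \<sigma>_pos by (simp add: field_simps power2_eq_square)
    then have "exp (- (x\<^sup>2 / (2 * \<sigma>\<^sup>2))) * exp (\<beta> * x) =
        exp (\<beta>\<^sup>2 * \<sigma>\<^sup>2 / 2) * exp (- ((x - \<beta> * \<sigma>\<^sup>2)\<^sup>2 / (2 * \<sigma>\<^sup>2)))"
      by (simp flip: exp_add)
    then show ?thesis by (simp add: normal_density_def)
  qed
  have "integrable lborel (\<lambda>x. normal_density 0 \<sigma> x * exp (\<beta> * x))"
    unfolding eq using \<sigma>_pos by simp
  then show "integrable M (\<lambda>\<omega>. exp (\<beta> * X t \<omega>))"
    using distributed_integrable[OF normal[OF assms], of "\<lambda>x. exp (\<beta> * x)"] by simp
  have "(\<integral>x. normal_density 0 \<sigma> x * exp (\<beta> * x) \<partial>lborel) = exp (\<beta>\<^sup>2 * \<sigma>\<^sup>2 / 2)"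
    unfolding eq using \<sigma>_pos by simp
  then show "expectation (\<lambda>\<omega>. exp (\<beta> * X t \<omega>)) = exp (\<beta>\<^sup>2 * \<sigma>\<^sup>2 / 2)"
    using distributed_integral[OF normal[OF assms], of "\<lambda>x. exp (\<beta> * x)"] by simp
qed

text \<open>An annealed bound from ln x \<le> x - 1. It is of order \<beta>^2 near 0, so it still
  vanishes after division by \<beta>.\<close>

lemma expectation_log_mean_exp_le:
  assumes "T \<noteq> {}"
  shows "expectation (\<lambda>\<omega>. log_mean_exp T (\<lambda>t. \<beta> * X t \<omega>)) \<le> exp (\<beta>\<^sup>2 * \<sigma>\<^sup>2 / 2) - 1"
proof -
  have "expectation (\<lambda>\<omega>. log_mean_exp T (\<lambda>t. \<beta> * X t \<omega>)) \<le>
      expectation (\<lambda>\<omega>. 1 / real (card T) * (\<Sum>t\<in>T. exp (\<beta> * X t \<omega>)) - 1)"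
    using assms log_mean_exp_le_mean_minus_1[OF fin assms] expectation_exp_X(1)
    by (intro integral_mono integrable_log_mean_exp Bochner_Integration.integrable_diff
        integrable_mult_right Bochner_Integration.integrable_sum) auto
  also have "\<dots> = 1 / real (card T) * (\<Sum>t\<in>T. expectation (\<lambda>\<omega>. exp (\<beta> * X t \<omega>))) - 1"
    using expectation_exp_X(1) by (simp add: prob_space)
  also have "\<dots> = exp (\<beta>\<^sup>2 * \<sigma>\<^sup>2 / 2) - 1"
    using assms fin by (simp add: expectation_exp_X(2))
  finally show ?thesis .
qed

lemma free_energy_pos_eq:
  "free_energy_pos M T X \<beta> = expectation (\<lambda>\<omega>. log_mean_exp T (\<lambda>t. \<beta> * X t \<omega>)) / \<beta>"
  by (simp add: free_energy_pos_def log_mean_exp_def)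

lemma free_energy_0:
  assumes "T \<noteq> {}" shows "free_energy M T X 0 = 0"
proof -
  have "((\<lambda>\<beta>. (exp (\<beta>\<^sup>2 * \<sigma>\<^sup>2 / 2) - 1) / \<beta>) \<longlongrightarrow> 0) (at_right 0)"
  proof -
    \<comment> \<open>The upper sandwich function is the difference quotient at 0 of this
      exponential.\<close>
    have "((\<lambda>\<beta>. exp (\<beta>\<^sup>2 * \<sigma>\<^sup>2 / 2)) has_real_derivative 0) (at 0)"
      by (auto intro!: derivative_eq_intros)
    then have "((\<lambda>\<beta>. (exp (\<beta>\<^sup>2 * \<sigma>\<^sup>2 / 2) - 1) / \<beta>) \<longlongrightarrow> 0) (at 0)"
      by (simp add: has_field_derivative_iff)
    then show ?thesis by (rule filterlim_mono) (auto simp: at_le)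
  qed
  then have "(free_energy_pos M T X \<longlongrightarrow> 0) (at_right 0)"
  proof (rule tendsto_sandwich[rotated 3])
    show "\<forall>\<^sub>F \<beta> in at_right 0. 0 \<le> free_energy_pos M T X \<beta>"
      using expectation_log_mean_exp_nonneg[OF order_refl assms]
      by (intro eventually_at_right_less[THEN eventually_mono]) (auto simp: free_energy_pos_eq)
    show "\<forall>\<^sub>F \<beta> in at_right 0. free_energy_pos M T X \<beta> \<le> (exp (\<beta>\<^sup>2 * \<sigma>\<^sup>2 / 2) - 1) / \<beta>"
      using expectation_log_mean_exp_le[OF assms]
      by (intro eventually_at_right_less[THEN eventually_mono])
        (auto simp: free_energy_pos_eq intro!: divide_right_mono)
  qed simp
  then show ?thesis by (simp add: free_energy_def tendsto_Lim)
qed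

section \<open>The divergence bounds and the conclusion\<close>

text \<open>One bound for each alternative of the dichotomy: \<open>D \<le> G\<close> for the
  quadratic one, \<open>D \<le> ln (card T)\<close> for the logarithmic one.\<close>

lemma expectation_renyi_half_gibbs:
  assumes "T \<noteq> {}"
  defines "G \<equiv> \<lambda>\<beta>. expectation (\<lambda>\<omega>. log_mean_exp T (\<lambda>t. \<beta> * X t \<omega>))"
    and "D \<equiv> \<lambda>\<beta>. expectation (\<lambda>\<omega>. renyi_divergence (1/2) T
      (gibbs T (\<lambda>t. X t \<omega>) \<beta>) (gibbs T (\<lambda>t. X t \<omega>) 0))"
  shows "D \<beta> \<le> G \<beta>" and "D \<beta> \<le> ln (real (card T))"
proof -
  note int = integrable_log_mean_exp[OF order_refl assms(1)]
  have "D \<beta> = G \<beta> - 2 * G (\<beta> / 2)"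
    unfolding D_def G_def renyi_half_gibbs[OF fin assms(1)] using int[of \<beta>] int[of "\<beta> / 2"] by simp
  then show "D \<beta> \<le> G \<beta>"
    using expectation_log_mean_exp_nonneg[OF order_refl assms(1), of "\<beta> / 2"] unfolding G_def by linarith
  have "D \<beta> \<le> expectation (\<lambda>_. ln (real (card T)))"
    unfolding D_def renyi_half_gibbs[OF fin assms(1)]
    using int[of \<beta>] int[of "\<beta> / 2"] renyi_half_gibbs_le[OF fin assms(1)]
    by (intro integral_mono) auto
  then show "D \<beta> \<le> ln (real (card T))" by (simp add: prob_space)
qed

lemma free_energy_ge:
  assumes c: "sudakov_constant c" "0 < c" and T: "T \<noteq> {}" and \<beta>: "0 \<le> \<beta>"
  shows "c * \<sigma> / 2 * sqrt (expectation (\<lambda>\<omega>. renyi_divergence (1/2) T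
      (gibbs T (\<lambda>t. X t \<omega>) \<beta>) (gibbs T (\<lambda>t. X t \<omega>) 0))) \<le> free_energy M T X \<beta>"
proof -
  define G where "G = expectation (\<lambda>\<omega>. log_mean_exp T (\<lambda>t. \<beta> * X t \<omega>))"
  define D where "D = expectation (\<lambda>\<omega>. renyi_divergence (1/2) T
      (gibbs T (\<lambda>t. X t \<omega>) \<beta>) (gibbs T (\<lambda>t. X t \<omega>) 0))"
  have DG: "D \<le> G" and DL: "D \<le> ln (real (card T))"
    unfolding D_def G_def by (rule expectation_renyi_half_gibbs[OF T])+
  have G0: "0 \<le> G" unfolding G_def by (rule expectation_log_mean_exp_nonneg[OF order_refl T])
  have "c * \<sigma> / 2 * sqrt D \<le> free_energy M T X \<beta>"
  proof (cases "\<beta> = 0")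
    case True
    then have "G = 0"
      using T fin by (simp add: G_def log_mean_exp_def)
    then have "c * \<sigma> / 2 * sqrt D \<le> 0"
      using DG c \<sigma>_pos by (intro mult_nonneg_nonpos) auto
    then show ?thesis using True free_energy_0[OF T] by simp
  next
    case False
    then have \<beta>: "0 < \<beta>" using \<beta> by simp
    have "c * (\<beta> * \<sigma>) / 2 * sqrt D \<le> G"
    \<comment> \<open>For a singleton \<open>D \<le> ln 1 = 0\<close>; the HOL square root is
      monotone on all reals, so \<open>sqrt D \<le> 0\<close>.\<close>
    proof (cases "card T = 1")
      case True
      then have "sqrt D \<le> 0" using DL by simp
      then have "c * (\<beta> * \<sigma>) / 2 * sqrt D \<le> 0"
        using c \<beta> \<sigma>_pos by (intro mult_nonneg_nonpos) auto
      then show ?thesis using G0 by simp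
    next
      case False
      moreover have "card T \<noteq> 0" using T fin by simp
      ultimately have card: "2 \<le> card T" by simp
      \<comment> \<open>Two distinct points make \<open>c \<le> 3 / 4\<close> available.\<close>
      then obtain s t where st: "s \<in> T" "t \<in> T" "s \<noteq> t"
        by (metis card_2_iff' obtain_subset_with_card_n subset_iff)
      have "c\<^sup>2 * (\<beta> * \<sigma>)\<^sup>2 / 4 \<le> G \<or> c * (\<beta> * \<sigma>) / 2 * sqrt (ln (real (card T))) \<le> G"
        unfolding G_def
        using \<beta> \<sigma>_pos c card expectation_log_mean_exp_ge_sudakov[OF c(1)]
          expectation_log_mean_exp_ge_pair[OF card]
        by (intro sudakov_scale_dichotomy[OF c(2) sudakov_constant_le[OF c(1) st]]) auto
      then show ?thesis
      proof
        \<comment> \<open>The prefactor and \<open>sqrt D\<close> are each at most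
          \<open>sqrt G\<close>, so their product is at most \<open>G\<close>.\<close>
        assume *: "c\<^sup>2 * (\<beta> * \<sigma>)\<^sup>2 / 4 \<le> G"
        have "c * (\<beta> * \<sigma>) / 2 \<le> sqrt G"
          using * by (intro real_le_rsqrt) (simp add: power_mult_distrib power_divide)
        have "c * (\<beta> * \<sigma>) / 2 * sqrt D \<le> c * (\<beta> * \<sigma>) / 2 * sqrt G"
          using DG c \<beta> \<sigma>_pos by (intro mult_left_mono) auto
        also have "\<dots> \<le> sqrt G * sqrt G"
          using \<open>c * (\<beta> * \<sigma>) / 2 \<le> sqrt G\<close> G0 by (intro mult_right_mono) auto
        finally show ?thesis using G0 by simp
      next
        assume *: "c * (\<beta> * \<sigma>) / 2 * sqrt (ln (real (card T))) \<le> G"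
        have "c * (\<beta> * \<sigma>) / 2 * sqrt D \<le> c * (\<beta> * \<sigma>) / 2 * sqrt (ln (real (card T)))"
          using DL c \<beta> \<sigma>_pos by (intro mult_left_mono) auto
        then show ?thesis using * by linarith
      qed
    qed
    then show ?thesis
      using \<beta> by (simp add: free_energy_def free_energy_pos_eq flip: G_def) (simp add: field_simps)
  qed
  then show ?thesis by (simp add: D_def)
qed

end

theorem theorem5:
  fixes c \<sigma> :: real and M :: "'w measure" and T :: "'i set" and X :: "'i \<Rightarrow> 'w \<Rightarrow> real"
  assumes "0 < c" and "c < 1" and "sudakov_constant c"
    and "prob_space M"
    and "finite T" and "T \<noteq> {}"
    and "0 < \<sigma>"
    and "prob_space.indep_vars M (\<lambda>_. borel) X T"
    and "\<And>t. t \<in> T \<Longrightarrow> distributed M lborel (X t) (normal_density 0 \<sigma>)"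
  shows "\<forall>\<beta>\<ge>0. free_energy M T X \<beta> \<ge>
    c * \<sigma> / 2 * sqrt (prob_space.expectation M
      (\<lambda>\<omega>. renyi_divergence (1/2) T (gibbs T (\<lambda>t. X t \<omega>) \<beta>) (gibbs T (\<lambda>t. X t \<omega>) 0)))"
proof -
  interpret iid_centered_gaussian M T X \<sigma>
    using assms by (simp add: iid_centered_gaussian_def iid_centered_gaussian_axioms_def)
  show ?thesis using free_energy_ge[OF assms(3,1,6)] by blast
qed

end
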